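(* For any $k\ge3$, every fully symmetric and contracting $k$-peg Hanoi group is a subgroup of $H_c^{(k)}$.
   Context: Let $\mathsf{X}$ be a finite alphabet and $\mathsf{X}^*$ the set of finite words over $\mathsf{X}$, viewed as a rooted tree; $\operatorname{Aut}\mathsf{X}^*$ is the group of permutations of $\mathsf{X}^*$ preserving word length and common prefixes. For $g\in\operatorname{Aut}\mathsf{X}^*$, the root permutation $\sigma_g\in\operatorname{Sym}(\mathsf{X})$ is the restriction of $g$ to one-letter words, and for $x\in\mathsf{X}$ the section $g|_x\in\operatorname{Aut}\mathsf{X}^*$ is defined by $g(xw)=\sigma_g(x)\,g|_x(w)$ for all $w\in\mathsf{X}^*$. For $w=x_n\ldots x_1$ with $n\ge2$ set $g|_w=(g|_{x_n})|_{x_{n-1}\ldots x_1}$ inductively. A self-similar group $(G,\mathsf{X})$ is a group $G$ with a faithful action by automorphisms on $\mathsf{X}^*$ (so $G$ is identified with a subgroup of $\operatorname{Aut}\mathsf{X}^*$) such that $g|_x\in G$ for all $g\in G$, $x\in\mathsf{X}$. It is contracting if there is a finite set $\mathcal{N}\subset G$ such that for every $g\in G$ there is $n\in\mathbb{N}$ with $g|_v\in\mathcal{N}$ for all words $v\in\mathsf{X}^*$ with $|v|\ge n$. Let $\mathsf{X}_k=\{0,\dots,k-1\}$. A $k$-peg Hanoi automorphism is an $a\in\operatorname{Aut}\mathsf{X}_k^*$ for which there are disjoint subsets $P_a,Q_a$ of $\mathsf{X}_k$ with $P_a\cup Q_a=\mathsf{X}_k$, $a|_i=1$ for each $i\in P_a$,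 $a|_j=a$ for each $j\in Q_a$, and $\sigma_a$ fixing each element of $Q_a$. For $a\ne1$ these sets, if they exist, are uniquely determined; $P_a$ is the set of active pegs and $Q_a$ the set of inactive pegs of $a$. The set of inactive pegs of the identity is defined to be $\mathsf{X}_k$. Let $S_{k,q}$ be the set of $k$-peg Hanoi automorphisms with exactly $q$ inactive pegs and $S_k=\bigcup_q S_{k,q}$. A Hanoi automorphism is determined by $Q_a$ and $\sigma_a$. A $k$-peg Hanoi group is a group $G\le\operatorname{Aut}\mathsf{X}_k^*$ together with a fixed generating set $S\subset S_k$ with $1\in S$ that is state-closed (contains all sections of its elements); every such group is self-similar. $H_c^{(k)}$ is the $k$-peg Hanoi group generated by $S_{k,1}\cup\{1\}$. The group $\operatorname{Sym}(\mathsf{X}_k)$ acts on $S_k$: for $\phi\in\operatorname{Sym}(\mathsf{X}_k)$ and $a\in S_k$, $\phi\cdot a$ is the Hanoi automorphism with set of inactive pegs $\phi(Q_a)$ and root permutation $\phi\sigma_a\phi^{-1}$. A $k$-peg Hanoi group with generating set $S$ is fully symmetric if $\phi\cdot S\subset S$ for all $\phi\in\operatorname{Sym}(\mathsf{X}_k)$.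
   Formalization: The union S_k is taken over q ≥ 1, so every generator has at least one inactive peg; with q = 0 allowed the claim fails, e.g. for the finite group of all permutations of the first letter. *)

theory Defs
  imports "HOL-Algebra.Bij" "HOL-Algebra.Generated_Groups" "HOL-Combinatorics.Permutations"
begin

text \<open>
  Words over \<open>X\<close> are the elements of \<^term>\<open>lists X\<close>. As in \<^const>\<open>BijGroup\<close>, a permutation of
  \<^term>\<open>lists X\<close> is an extensional function (\<^const>\<open>undefined\<close> off \<^term>\<open>lists X\<close>), so that equality
  of automorphisms is equality of functions. The product \<open>g \<otimes> h\<close> is ``first \<open>h\<close>, then \<open>g\<close>''.
\<close>

definition tree_aut :: "'a set \<Rightarrow> ('a list \<Rightarrow> 'a list) set" where
  "tree_aut X = {g \<in> Bij (lists X).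
     (\<forall>w\<in>lists X. length (g w) = length w) \<and>
     (\<forall>u\<in>lists X. \<forall>v\<in>lists X. \<forall>n. take n u = take n v \<longrightarrow> take n (g u) = take n (g v))}"

definition tree_aut_group :: "'a set \<Rightarrow> ('a list \<Rightarrow> 'a list) monoid" where
  "tree_aut_group X = (BijGroup (lists X))\<lparr>carrier := tree_aut X\<rparr>"

text \<open>Root permutation, extended by the identity outside \<open>X\<close> so that it fits \<^const>\<open>permutes\<close>.\<close>

definition root_perm :: "'a set \<Rightarrow> ('a list \<Rightarrow> 'a list) \<Rightarrow> 'a \<Rightarrow> 'a" where
  "root_perm X g = (\<lambda>x. if x \<in> X then hd (g [x]) else x)"

text \<open>
  For \<open>g \<in> tree_aut X\<close> and \<open>x \<in> X\<close> the word \<open>g (x # w)\<close> starts with \<open>root_perm X g x\<close>;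
  the section is what \<open>g\<close> does to the rest: \<open>g (x # w) = root_perm X g x # letter_section X g x w\<close>.
\<close>

definition letter_section :: "'a set \<Rightarrow> ('a list \<Rightarrow> 'a list) \<Rightarrow> 'a \<Rightarrow> 'a list \<Rightarrow> 'a list" where
  "letter_section X g x = (\<lambda>w\<in>lists X. tl (g (x # w)))"

primrec word_section :: "'a set \<Rightarrow> ('a list \<Rightarrow> 'a list) \<Rightarrow> 'a list \<Rightarrow> 'a list \<Rightarrow> 'a list" where
  "word_section X g [] = g"
| "word_section X g (x # w) = word_section X (letter_section X g x) w"

definition contracting :: "'a set \<Rightarrow> ('a list \<Rightarrow> 'a list) set \<Rightarrow> bool" where
  "contracting X G \<longleftrightarrow>
     (\<exists>N. finite N \<and> N \<subseteq> G \<and>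
        (\<forall>g\<in>G. \<exists>n::nat. \<forall>v\<in>lists X. n \<le> length v \<longrightarrow> word_section X g v \<in> N))"

abbreviation pegs :: "nat \<Rightarrow> nat set" where
  "pegs k \<equiv> {..<k}"

definition hanoi_partition ::
    "nat \<Rightarrow> (nat list \<Rightarrow> nat list) \<Rightarrow> nat set \<Rightarrow> nat set \<Rightarrow> bool" where
  "hanoi_partition k a P Q \<longleftrightarrow>
     P \<inter> Q = {} \<and> P \<union> Q = pegs k \<and>
     (\<forall>i\<in>P. letter_section (pegs k) a i = \<one>\<^bsub>tree_aut_group (pegs k)\<^esub>) \<and>
     (\<forall>j\<in>Q. letter_section (pegs k) a j = a) \<and>
     (\<forall>j\<in>Q. root_perm (pegs k) a j = j)"

definition hanoi_aut :: "nat \<Rightarrow> (nat list \<Rightarrow> nat list) \<Rightarrow> bool" where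
  "hanoi_aut k a \<longleftrightarrow> a \<in> tree_aut (pegs k) \<and> (\<exists>P Q. hanoi_partition k a P Q)"

text \<open>
  The description is unique for \<open>a \<noteq> 1\<close>: a peg in \<open>Q \<inter> P'\<close>, for two partitions \<open>(P, Q)\<close> and
  \<open>(P', Q')\<close>, would have both \<open>a\<close> and \<open>1\<close> as its section.
\<close>

definition inactive_pegs :: "nat \<Rightarrow> (nat list \<Rightarrow> nat list) \<Rightarrow> nat set" where
  "inactive_pegs k a =
     (if a = \<one>\<^bsub>tree_aut_group (pegs k)\<^esub> then pegs k else (THE Q. \<exists>P. hanoi_partition k a P Q))"

definition hanoi_auts_q :: "nat \<Rightarrow> nat \<Rightarrow> (nat list \<Rightarrow> nat list) set" where
  "hanoi_auts_q k q = {a. hanoi_aut k a \<and> card (inactive_pegs k a) = q}"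

text \<open>
  The union is over \<open>q \<ge> 1\<close>: a generator has at least one inactive peg. If the automorphisms
  without inactive pegs (those acting on the first letter only) were admitted, the finite group of
  all of them would be a fully symmetric contracting Hanoi group, yet not contained in the group
  generated by the automorphisms with one inactive peg: every \<open>g\<close> in the latter group has
  \<open>sgn \<sigma>\<^sub>g\<close> equal to the product of the signs of the root permutations of its sections at letters,
  which fails for a transposition of the first letter.
\<close>

definition hanoi_auts :: "nat \<Rightarrow> (nat list \<Rightarrow> nat list) set" where
  "hanoi_auts k = (\<Union>q\<in>{1..k}. hanoi_auts_q k q)"

definition hanoi_group ::
    "nat \<Rightarrow> (nat list \<Rightarrow> nat list) set \<Rightarrow> (nat list \<Rightarrow> nat list) set \<Rightarrow> bool" where
  "hanoi_group k G S \<longleftrightarrow>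
     subgroup G (tree_aut_group (pegs k)) \<and>
     S \<subseteq> hanoi_auts k \<and>
     \<one>\<^bsub>tree_aut_group (pegs k)\<^esub> \<in> S \<and>
     (\<forall>a\<in>S. \<forall>v\<in>lists (pegs k). word_section (pegs k) a v \<in> S) \<and>
     G = generate (tree_aut_group (pegs k)) S"

definition hanoi_c :: "nat \<Rightarrow> (nat list \<Rightarrow> nat list) set" where
  "hanoi_c k = generate (tree_aut_group (pegs k))
                 (hanoi_auts_q k 1 \<union> {\<one>\<^bsub>tree_aut_group (pegs k)\<^esub>})"

text \<open>
  For \<open>\<phi>\<close> permuting the pegs and \<open>a \<in> hanoi_auts k\<close> exactly one such \<open>b\<close> exists: the letterwise
  conjugate of \<open>a\<close> by \<open>\<phi>\<close>. It is unique because a Hanoi automorphism is determined by its inactive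
  pegs and its root permutation.
\<close>

definition peg_action ::
    "nat \<Rightarrow> (nat \<Rightarrow> nat) \<Rightarrow> (nat list \<Rightarrow> nat list) \<Rightarrow> nat list \<Rightarrow> nat list" where
  "peg_action k \<phi> a = (THE b. hanoi_aut k b \<and>
     inactive_pegs k b = \<phi> ` inactive_pegs k a \<and>
     root_perm (pegs k) b = \<phi> \<circ> root_perm (pegs k) a \<circ> inv_into UNIV \<phi>)"

definition fully_symmetric :: "nat \<Rightarrow> (nat list \<Rightarrow> nat list) set \<Rightarrow> bool" where
  "fully_symmetric k S \<longleftrightarrow> (\<forall>\<phi>. \<phi> permutes pegs k \<longrightarrow> peg_action k \<phi> ` S \<subseteq> S)"

end

theory Submission
  imports Defs
begin

text \<open>
  The claim is that a generator \<open>a \<noteq> 1\<close> of a fully symmetric contracting Hanoi group cannot have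
  two inactive pegs \<open>x \<noteq> y\<close> (\<open>inactive_peg_unique\<close>). As every generator has at least one inactive
  peg, all nontrivial generators then belong to the generating set of \<^term>\<open>hanoi_c k\<close>.

  Suppose that \<open>x\<close> and \<open>y\<close> are distinct inactive pegs of \<open>a\<close>, and let \<open>C\<close> consist of the conjugates
  of \<open>a\<close> by the permutations of the pegs that fix \<open>x\<close>; they all lie in the symmetric set of
  generators. Every element of \<open>C\<close> fixes the letter \<open>x\<close> and is its own section there. These two
  properties pass to products, and a group element that is its own section at \<open>x\<close> equals its
  section at every power of \<open>x\<close>, hence lies in the finite nucleus
  (\<open>contracting_finite_fixed_sections\<close>). So \<open>C\<close> generates only finitely many automorphisms.

  On the other hand the monoid generated by \<open>C\<close> is transitive on the words of each length over the
  remaining \<open>k - 1\<close> letters (\<open>steps_transitive\<close>). It is transitive on letters because \<open>a\<close> moves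
  some peg \<open>i\<close> to some \<open>i'\<close>, and conjugation turns \<open>(i, i')\<close> into any prescribed pair. It is
  self-replicating because of the second inactive peg: each \<open>b \<in> C\<close> has an inactive peg \<open>j \<noteq> x\<close>,
  and for \<open>z \<noteq> j\<close> one moves the first letter from \<open>z\<close> to \<open>j\<close>, applies \<open>b\<close>, and moves it back. Moving
  a letter makes it active, so it leaves the rest of the word unchanged, and the composite has \<open>b\<close>
  as its section at \<open>z\<close>. Orbits of size \<open>(k - 1) ^ n\<close> for all \<open>n\<close> contradict finiteness, since
  \<open>k - 1 \<ge> 2\<close>.
\<close>

section \<open>Tree automorphisms\<close>

lemma tree_aut_Bij: "g \<in> tree_aut X \<Longrightarrow> g \<in> Bij (lists X)"
  by (simp add: tree_aut_def)

lemma tree_aut_in_lists: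
  assumes "g \<in> tree_aut X" "w \<in> lists X" shows "g w \<in> lists X"
  using Bij_imp_funcset[OF tree_aut_Bij[OF assms(1)]] assms(2) by blast

lemma tree_aut_length:
  "g \<in> tree_aut X \<Longrightarrow> w \<in> lists X \<Longrightarrow> length (g w) = length w"
  by (simp add: tree_aut_def)

lemma tree_aut_inj_on: "g \<in> tree_aut X \<Longrightarrow> inj_on g (lists X)"
  by (simp add: tree_aut_def Bij_def bij_betw_def)

lemma take_in_lists: "w \<in> lists X \<Longrightarrow> take n w \<in> lists X"
  by (meson in_listsI in_listsD in_set_takeD)

lemma tree_aut_take:
  assumes "g \<in> tree_aut X" "w \<in> lists X" shows "g (take n w) = take n (g w)"
proof -
  have "take n w \<in> lists X" using assms(2) by (rule take_in_lists)
  moreover have "take n (take n w) = take n w" by simp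
  ultimately have "take n (g (take n w)) = take n (g w)"
    using assms unfolding tree_aut_def by blast
  moreover have "length (g (take n w)) \<le> n"
    using tree_aut_length[OF assms(1) \<open>take n w \<in> lists X\<close>] by simp
  ultimately show ?thesis by simp
qed

text \<open>
  Commuting with truncation is a condition on one word at a time, unlike the preservation of common
  prefixes; this makes the closure properties below short.
\<close>

lemma tree_autI:
  assumes "g \<in> Bij (lists X)" "\<And>w. w \<in> lists X \<Longrightarrow> length (g w) = length w"
    "\<And>n w. w \<in> lists X \<Longrightarrow> g (take n w) = take n (g w)"
  shows "g \<in> tree_aut X"
  using assms unfolding tree_aut_def by (simp, metis)

lemma tree_aut_Cons:
  assumes g: "g \<in> tree_aut X" and x: "x \<in> X" and w: "w \<in> lists X"
  shows "g (x # w) = root_perm X g x # letter_section X g x w"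
proof -
  have xw: "x # w \<in> lists X" using x w by simp
  have ne: "g (x # w) \<noteq> []" using tree_aut_length[OF g xw] by auto
  have "g [x] = take 1 (g (x # w))" using tree_aut_take[OF g xw, of 1] by simp
  then have "hd (g [x]) = hd (g (x # w))" using ne by simp
  then show ?thesis using ne x w by (simp add: root_perm_def letter_section_def)
qed

lemma tree_aut_Nil: "g \<in> tree_aut X \<Longrightarrow> g [] = []"
  using tree_aut_length[of g X "[]"] by simp

lemma tree_aut_singleton: "g \<in> tree_aut X \<Longrightarrow> x \<in> X \<Longrightarrow> g [x] = [root_perm X g x]"
  using tree_aut_Cons[of g X x "[]"] tree_aut_length[of g X "[x]"] by simp

lemma root_perm_in: "g \<in> tree_aut X \<Longrightarrow> x \<in> X \<Longrightarrow> root_perm X g x \<in> X"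
  using tree_aut_in_lists[of g X "[x]"] tree_aut_singleton[of g X x] by simp

lemma tree_aut_eqI:
  assumes "g \<in> tree_aut X" "h \<in> tree_aut X" "\<And>w. w \<in> lists X \<Longrightarrow> g w = h w"
  shows "g = h"
proof (rule extensionalityI)
  show "g \<in> extensional (lists X)" "h \<in> extensional (lists X)"
    using assms(1,2) by (simp_all add: tree_aut_def Bij_def)
qed (rule assms(3))

lemma one_tree_aut_group: "\<one>\<^bsub>tree_aut_group X\<^esub> = (\<lambda>w\<in>lists X. w)"
  by (simp add: tree_aut_group_def BijGroup_def)

lemma mult_tree_aut_group:
  "g \<in> tree_aut X \<Longrightarrow> h \<in> tree_aut X \<Longrightarrow> g \<otimes>\<^bsub>tree_aut_group X\<^esub> h = compose (lists X) g h"
  by (simp add: tree_aut_group_def BijGroup_def tree_aut_def)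

lemma carrier_tree_aut_group: "carrier (tree_aut_group X) = tree_aut X"
  by (simp add: tree_aut_group_def)

lemma id_in_tree_aut: "(\<lambda>w\<in>lists X. w) \<in> tree_aut X"
  using id_Bij[of "lists X"] by (intro tree_autI) (auto simp: take_in_lists restrict_def)

lemma subgroup_tree_aut: "subgroup (tree_aut X) (BijGroup (lists X))"
proof (rule group.subgroupI[OF group_BijGroup])
  show "tree_aut X \<subseteq> carrier (BijGroup (lists X))"
    by (auto simp: BijGroup_def tree_aut_def)
  show "tree_aut X \<noteq> {}" using id_in_tree_aut by blast
next
  fix g assume g: "g \<in> tree_aut X"
  define h where "h = (\<lambda>w\<in>lists X. inv_into (lists X) g w)"
  have hB: "h \<in> Bij (lists X)" unfolding h_def by (rule restrict_inv_into_Bij[OF tree_aut_Bij[OF g]])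
  have hl: "h w \<in> lists X" if "w \<in> lists X" for w
    using Bij_imp_funcset[OF hB] that by blast
  have gh: "g (h w) = w" if "w \<in> lists X" for w
    using tree_aut_Bij[OF g] that
    by (simp add: h_def Bij_def bij_betw_def f_inv_into_f)
  have "h \<in> tree_aut X"
  proof (rule tree_autI[OF hB])
    show "length (h w) = length w" if "w \<in> lists X" for w
      using tree_aut_length[OF g hl[OF that]] gh[OF that] by simp
    show "h (take n w) = take n (h w)" if w: "w \<in> lists X" for n w
    proof (rule inj_onD[OF tree_aut_inj_on[OF g]])
      show "g (h (take n w)) = g (take n (h w))"
        using gh[OF w] gh[OF take_in_lists[OF w]] tree_aut_take[OF g hl[OF w]] by simp
    qed (rule hl take_in_lists w)+
  qed
  then show "inv\<^bsub>BijGroup (lists X)\<^esub> g \<in> tree_aut X"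
    using inv_BijGroup[OF tree_aut_Bij[OF g]] by (simp add: h_def)
next
  fix g h assume g: "g \<in> tree_aut X" and h: "h \<in> tree_aut X"
  have "compose (lists X) g h \<in> tree_aut X"
  proof (rule tree_autI)
    show "compose (lists X) g h \<in> Bij (lists X)"
      using g h by (simp add: compose_Bij tree_aut_Bij)
    show "length (compose (lists X) g h w) = length w" if "w \<in> lists X" for w
      using that g h by (simp add: compose_eq tree_aut_length tree_aut_in_lists del: in_lists_conv_set)
    show "compose (lists X) g h (take n w) = take n (compose (lists X) g h w)"
      if "w \<in> lists X" for n w
      using that take_in_lists[OF that, of n] tree_aut_in_lists[OF h that] g h
      by (simp add: compose_eq tree_aut_take del: in_lists_conv_set)
  qed
  then show "g \<otimes>\<^bsub>BijGroup (lists X)\<^esub> h \<in> tree_aut X"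
    using g h by (simp add: BijGroup_def tree_aut_Bij)
qed

lemma group_tree_aut_group: "group (tree_aut_group X)"
  unfolding tree_aut_group_def
  by (rule group.subgroup_imp_group[OF group_BijGroup subgroup_tree_aut])


section \<open>Hanoi automorphisms and their conjugates\<close>

lemma hanoi_partition_Cons:
  assumes "hanoi_partition k a P Q" "a \<in> tree_aut (pegs k)" "w \<in> lists (pegs k)" "i < k"
  shows "a (i # w) = root_perm (pegs k) a i # (if i \<in> Q then a w else w)"
proof -
  have "i \<in> P \<or> i \<in> Q" "i \<notin> P \<inter> Q" using assms by (auto simp: hanoi_partition_def)
  then show ?thesis using tree_aut_Cons[OF assms(2), of i w] assms
    by (auto simp: hanoi_partition_def one_tree_aut_group)
qed

text \<open>
  The recursion \<open>hanoi_partition_Cons\<close> computes a Hanoi automorphism from its inactive pegs and its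
  root permutation, so induction on the word gives the next two facts.
\<close>

lemma hanoi_partition_determines:
  assumes a: "a \<in> tree_aut (pegs k)" "hanoi_partition k a P Q"
    and b: "b \<in> tree_aut (pegs k)" "hanoi_partition k b P' Q"
    and \<sigma>: "root_perm (pegs k) a = root_perm (pegs k) b"
  shows "a = b"
proof (rule tree_aut_eqI[OF a(1) b(1)])
  fix w assume "w \<in> lists (pegs k)"
  then show "a w = b w"
  proof (induction w)
    case Nil then show ?case using a b by (simp add: tree_aut_Nil)
  next
    case (Cons i w)
    then show ?case
      using hanoi_partition_Cons[OF a(2,1)] hanoi_partition_Cons[OF b(2,1)] \<sigma> by simp
  qed
qed

lemma hanoi_partition_id:
  assumes "hanoi_partition k a P Q" "a \<in> tree_aut (pegs k)" "root_perm (pegs k) a = id"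
  shows "a = \<one>\<^bsub>tree_aut_group (pegs k)\<^esub>"
  unfolding one_tree_aut_group
proof (rule tree_aut_eqI[OF assms(2) id_in_tree_aut])
  fix w assume "w \<in> lists (pegs k)"
  then show "a w = (\<lambda>w\<in>lists (pegs k). w) w"
  proof (induction w)
    case Nil then show ?case using assms by (simp add: tree_aut_Nil)
  next
    case (Cons i w)
    then show ?case using hanoi_partition_Cons[OF assms(1,2)] assms(3) by simp
  qed
qed

lemma inactive_pegs_eq:
  assumes "hanoi_partition k a P Q" "a \<noteq> \<one>\<^bsub>tree_aut_group (pegs k)\<^esub>"
  shows "inactive_pegs k a = Q"
proof -
  have sub: "R \<subseteq> R'" if "hanoi_partition k a P\<^sub>1 R" "hanoi_partition k a P\<^sub>2 R'" for P\<^sub>1 P\<^sub>2 R R'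
  proof
    fix i assume "i \<in> R"
    then have "letter_section (pegs k) a i = a" "i \<in> P\<^sub>2 \<union> R'"
      using that unfolding hanoi_partition_def by blast+
    then show "i \<in> R'" using that(2) assms(2) unfolding hanoi_partition_def by force
  qed
  then have "R = Q" if "hanoi_partition k a P' R" for P' R using that assms(1) by blast
  then have "(THE Q. \<exists>P. hanoi_partition k a P Q) = Q"
    using assms(1) by (intro the_equality) blast+
  then show ?thesis using assms(2) by (simp add: inactive_pegs_def)
qed

lemma hanoi_partition_one:
  "hanoi_partition k \<one>\<^bsub>tree_aut_group (pegs k)\<^esub> {} (pegs k)"
  by (auto simp: hanoi_partition_def one_tree_aut_group letter_section_def root_perm_def
        restrict_def fun_eq_iff)

lemma hanoi_aut_partition:
  assumes "hanoi_aut k a"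
  obtains P where "hanoi_partition k a P (inactive_pegs k a)"
proof (cases "a = \<one>\<^bsub>tree_aut_group (pegs k)\<^esub>")
  case True
  then have "inactive_pegs k a = pegs k" by (simp add: inactive_pegs_def)
  with True hanoi_partition_one show ?thesis using that by metis
next
  case False
  then show ?thesis using assms that inactive_pegs_eq unfolding hanoi_aut_def by metis
qed

text \<open>
  Conjugation by the letterwise action of \<open>\<phi>\<close>: an explicit form of \<^const>\<open>peg_action\<close>, which is
  only characterised by a description (see \<open>peg_action_eq_relabel\<close>).
\<close>

definition relabel :: "nat \<Rightarrow> (nat \<Rightarrow> nat) \<Rightarrow> (nat list \<Rightarrow> nat list) \<Rightarrow> nat list \<Rightarrow> nat list" where
  "relabel k \<phi> a = (\<lambda>w\<in>lists (pegs k). map \<phi> (a (map (inv_into UNIV \<phi>) w)))"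

lemma map_permutes_in_lists: "\<phi> permutes X \<Longrightarrow> w \<in> lists X \<Longrightarrow> map \<phi> w \<in> lists X"
  by (auto simp: permutes_in_image)

lemma relabel_in_tree_aut:
  assumes \<phi>: "\<phi> permutes pegs k" and a: "a \<in> tree_aut (pegs k)"
  shows "relabel k \<phi> a \<in> tree_aut (pegs k)"
proof (rule tree_autI)
  let ?L = "lists (pegs k)"
  note \<psi> = permutes_inv[OF \<phi>]
  have bm: "bij_betw (map \<theta>) ?L ?L" if "\<theta> permutes pegs k" for \<theta>
    unfolding bij_betw_def
    using inj_on_subset[OF inj_mapI[OF permutes_inj[OF that]] subset_UNIV]
    by (simp only: lists_image[symmetric] permutes_image[OF that])
  have "bij_betw a ?L ?L" using tree_aut_Bij[OF a] by (simp add: Bij_def)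
  from bij_betw_trans[OF bij_betw_trans[OF bm[OF \<psi>] this] bm[OF \<phi>]]
  have "bij_betw (relabel k \<phi> a) ?L ?L"
    by (rule bij_betw_cong[THEN iffD1, rotated]) (simp add: relabel_def)
  then show "relabel k \<phi> a \<in> Bij ?L" by (simp add: Bij_def relabel_def)
  show "length (relabel k \<phi> a w) = length w" if "w \<in> ?L" for w
    using that tree_aut_length[OF a map_permutes_in_lists[OF \<psi> that]] by (simp add: relabel_def)
  show "relabel k \<phi> a (take n w) = take n (relabel k \<phi> a w)" if "w \<in> ?L" for n w
    using that take_in_lists[OF that, of n] tree_aut_take[OF a map_permutes_in_lists[OF \<psi> that], of n]
    by (simp add: relabel_def take_map del: in_lists_conv_set)
qed

lemma root_perm_relabel:
  assumes \<phi>: "\<phi> permutes pegs k" and a: "a \<in> tree_aut (pegs k)"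
  shows "root_perm (pegs k) (relabel k \<phi> a) = \<phi> \<circ> root_perm (pegs k) a \<circ> inv_into UNIV \<phi>"
proof
  fix i
  note \<psi> = permutes_inv[OF \<phi>]
  show "root_perm (pegs k) (relabel k \<phi> a) i = (\<phi> \<circ> root_perm (pegs k) a \<circ> inv_into UNIV \<phi>) i"
  proof (cases "i < k")
    case True
    then have "inv_into UNIV \<phi> i < k" using permutes_in_image[OF \<psi>, of i] by simp
    then have "relabel k \<phi> a [i] = [\<phi> (root_perm (pegs k) a (inv_into UNIV \<phi> i))]"
      using True tree_aut_singleton[OF a, of "inv_into UNIV \<phi> i"] by (simp add: relabel_def)
    then show ?thesis using True by (simp add: root_perm_def)
  next
    case False
    then have "inv_into UNIV \<phi> i = i" "\<phi> i = i" using permutes_not_in[OF \<psi>, of i] permutes_not_in[OF \<phi>, of i] by auto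
    then show ?thesis using False by (simp add: root_perm_def)
  qed
qed

lemma hanoi_partition_relabel:
  assumes \<phi>: "\<phi> permutes pegs k" and a: "a \<in> tree_aut (pegs k)" and PQ: "hanoi_partition k a P Q"
  shows "hanoi_partition k (relabel k \<phi> a) (\<phi> ` P) (\<phi> ` Q)"
proof -
  note \<psi> = permutes_inv[OF \<phi>]
  have sec: "letter_section (pegs k) (relabel k \<phi> a) (\<phi> i) =
      (\<lambda>w\<in>lists (pegs k). if i \<in> Q then relabel k \<phi> a w else w)" if "i < k" for i
  proof -
    have "\<phi> i < k" using permutes_in_image[OF \<phi>, of i] that by simp
    moreover have "tl (map \<phi> (a (i # map (inv_into UNIV \<phi>) w))) =
        (if i \<in> Q then relabel k \<phi> a w else w)" if "w \<in> lists (pegs k)" for w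
      using hanoi_partition_Cons[OF PQ a map_permutes_in_lists[OF \<psi> that] \<open>i < k\<close>] that
      by (simp add: relabel_def permutes_inverses[OF \<phi>] map_idI)
    ultimately show ?thesis
      by (auto simp: letter_section_def relabel_def permutes_inverses[OF \<phi>] fun_eq_iff restrict_def)
  qed
  have ext: "(\<lambda>w\<in>lists (pegs k). relabel k \<phi> a w) = relabel k \<phi> a"
    by (simp add: relabel_def restrict_def fun_eq_iff)
  have U: "P \<union> Q = pegs k" "P \<inter> Q = {}" using PQ by (auto simp: hanoi_partition_def)
  have lt: "i < k" if "i \<in> P \<or> i \<in> Q" for i using U that by auto
  show ?thesis unfolding hanoi_partition_def
  proof (intro conjI ballI)
    show "\<phi> ` P \<inter> \<phi> ` Q = {}" using U(2) permutes_inj[OF \<phi>] by (auto dest: injD)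
    show "\<phi> ` P \<union> \<phi> ` Q = pegs k"
      using U(1) permutes_image[OF \<phi>] by (simp add: image_Un[symmetric])
    fix j
    { assume "j \<in> \<phi> ` P"
      then obtain i where "j = \<phi> i" "i \<in> P" by blast
      moreover from this have "i \<notin> Q" using U(2) by blast
      ultimately show "letter_section (pegs k) (relabel k \<phi> a) j = \<one>\<^bsub>tree_aut_group (pegs k)\<^esub>"
        using sec[OF lt] by (simp add: one_tree_aut_group) }
    { assume "j \<in> \<phi> ` Q"
      then obtain i where i: "j = \<phi> i" "i \<in> Q" by blast
      then show "letter_section (pegs k) (relabel k \<phi> a) j = relabel k \<phi> a"
        using sec[OF lt] by (simp add: ext)
      show "root_perm (pegs k) (relabel k \<phi> a) j = j"
        using i PQ by (simp add: root_perm_relabel[OF \<phi> a] permutes_inverses[OF \<phi>] hanoi_partition_def) }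
  qed
qed

lemma peg_action_eq_relabel:
  assumes \<phi>: "\<phi> permutes pegs k" and a: "hanoi_aut k a" "a \<noteq> \<one>\<^bsub>tree_aut_group (pegs k)\<^esub>"
  shows "peg_action k \<phi> a = relabel k \<phi> a"
proof -
  let ?\<sigma> = "root_perm (pegs k)" and ?b = "relabel k \<phi> a"
  have at: "a \<in> tree_aut (pegs k)" using a(1) by (simp add: hanoi_aut_def)
  obtain P where PQ: "hanoi_partition k a P (inactive_pegs k a)"
    using hanoi_aut_partition[OF a(1)] .
  note bt = relabel_in_tree_aut[OF \<phi> at] and bp = hanoi_partition_relabel[OF \<phi> at PQ]
    and b\<sigma> = root_perm_relabel[OF \<phi> at]
  have "?b \<noteq> \<one>\<^bsub>tree_aut_group (pegs k)\<^esub>"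
  proof
    assume "?b = \<one>\<^bsub>tree_aut_group (pegs k)\<^esub>"
    then have "?\<sigma> ?b = id" by (auto simp: root_perm_def one_tree_aut_group)
    then have e: "(\<phi> \<circ> ?\<sigma> a \<circ> inv_into UNIV \<phi>) (\<phi> i) = \<phi> i" for i by (simp only: b\<sigma> id_apply)
    have "?\<sigma> a = id"
    proof
      fix i
      have "\<phi> (?\<sigma> a i) = \<phi> i" using e[of i] by (simp add: permutes_inverses[OF \<phi>])
      then show "?\<sigma> a i = id i" using permutes_inj[OF \<phi>] by (simp add: inj_eq)
    qed
    then show False using hanoi_partition_id[OF PQ at] a(2) by blast
  qed
  then have bQ: "inactive_pegs k ?b = \<phi> ` inactive_pegs k a" by (rule inactive_pegs_eq[OF bp])
  show ?thesis unfolding peg_action_def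
  proof (rule the_equality)
    show "hanoi_aut k ?b \<and> inactive_pegs k ?b = \<phi> ` inactive_pegs k a \<and>
        ?\<sigma> ?b = \<phi> \<circ> ?\<sigma> a \<circ> inv_into UNIV \<phi>"
      using bt bp bQ b\<sigma> by (auto simp: hanoi_aut_def)
  next
    fix c assume c: "hanoi_aut k c \<and> inactive_pegs k c = \<phi> ` inactive_pegs k a \<and>
        ?\<sigma> c = \<phi> \<circ> ?\<sigma> a \<circ> inv_into UNIV \<phi>"
    then obtain P' where "hanoi_partition k c P' (\<phi> ` inactive_pegs k a)"
      using hanoi_aut_partition by metis
    then show "c = ?b" using hanoi_partition_determines[OF _ _ bt bp] c b\<sigma>
      by (auto simp: hanoi_aut_def)
  qed
qed


section \<open>Two inactive pegs contradict contraction\<close>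

text \<open>If \<open>g|\<^sub>x = g\<close> then \<open>g\<close> is its own section at \<open>x\<^sup>n\<close> for every \<open>n\<close>, so it is in the nucleus.\<close>

lemma contracting_finite_fixed_sections:
  assumes "contracting X G" "x \<in> X"
  shows "finite {g \<in> G. letter_section X g x = g}"
proof -
  obtain N where N: "finite N"
    "\<And>g. g \<in> G \<Longrightarrow> \<exists>n. \<forall>v\<in>lists X. n \<le> length v \<longrightarrow> word_section X g v \<in> N"
    using assms(1) unfolding contracting_def by blast
  have "g \<in> N" if g: "g \<in> G" "letter_section X g x = g" for g
  proof -
    obtain n where "\<forall>v\<in>lists X. n \<le> length v \<longrightarrow> word_section X g v \<in> N" using N(2)[OF g(1)] by blast
    moreover have "replicate n x \<in> lists X" using assms(2) by auto
    ultimately have "word_section X g (replicate n x) \<in> N" by simp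
    moreover have "word_section X g (replicate m x) = g" for m by (induction m) (simp_all add: g(2))
    ultimately show ?thesis by simp
  qed
  then show ?thesis using N(1) by (auto intro: finite_subset)
qed

lemma letter_section_mult_fixed:
  assumes g: "g \<in> tree_aut X" and h: "h \<in> tree_aut X" and x: "x \<in> X"
    and fix1: "h [x] = [x]" "letter_section X g x = g" "letter_section X h x = h"
  shows "letter_section X (g \<otimes>\<^bsub>tree_aut_group X\<^esub> h) x = g \<otimes>\<^bsub>tree_aut_group X\<^esub> h"
proof -
  have "tl (g (h (x # w))) = g (h w)" if w: "w \<in> lists X" for w
  proof -
    have hx: "h (x # w) = x # h w"
      using tree_aut_Cons[OF h x w] fix1 x by (simp add: root_perm_def)
    show ?thesis
      using tree_aut_Cons[OF g x tree_aut_in_lists[OF h w]] fix1 by (simp add: hx)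
  qed
  then show ?thesis using x
    by (auto simp: mult_tree_aut_group[OF g h] letter_section_def compose_def restrict_def fun_eq_iff)
qed

text \<open>
  Transitivity is expressed by reachability in this relation, without naming the products of
  elements of \<open>C\<close> that carry one word to the other.
\<close>

definition steps :: "('a list \<Rightarrow> 'a list) set \<Rightarrow> 'a set \<Rightarrow> 'a list rel" where
  "steps C X = {(u, c u) | c u. c \<in> C \<and> u \<in> lists X}"

lemma stepsI: "c \<in> C \<Longrightarrow> u \<in> lists X \<Longrightarrow> c u = v \<Longrightarrow> (u, v) \<in> steps C X"
  unfolding steps_def by blast

text \<open>
  Used with \<open>i' = \<sigma>\<^sub>a i\<close>: conjugates of \<open>a\<close> by permutations that fix \<open>x\<close> can move any letter other
  than \<open>x\<close> to any other such letter.
\<close>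

lemma moved_pair_extends:
  assumes "i \<in> X - {x}" "i' \<in> X - {x}" "i \<noteq> i'" "j \<in> X - {x}" "z \<in> X - {x}" "j \<noteq> z" "x \<in> X"
  obtains \<phi> where "\<phi> permutes X" "\<phi> x = x" "\<phi> i = j" "\<phi> i' = z"
proof
  let ?t = "transpose i j i'"
  have t: "?t \<in> X - {x}" "?t \<noteq> j" using assms by (auto simp: transpose_def)
  show "transpose ?t z \<circ> transpose i j permutes X"
    using assms t by (intro permutes_compose permutes_swap_id) auto
  show "(transpose ?t z \<circ> transpose i j) x = x" using assms t by (auto simp: transpose_def)
  show "(transpose ?t z \<circ> transpose i j) i = j" using assms t by (auto simp: transpose_def)
  show "(transpose ?t z \<circ> transpose i j) i' = z" by simp
qed

text \<open>
  By induction on the length: lift the path from the tail of \<open>u\<close> to the tail of \<open>v\<close> below a common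
  first letter, after changing the first letter with one generator that keeps the tail. The second
  inactive peg \<open>y\<close> makes the lifting possible: a peg other than \<open>x\<close> is needed at which a given
  conjugate is its own section.
\<close>

lemma steps_transitive:
  assumes a: "a \<in> tree_aut (pegs k)" and PQ: "hanoi_partition k a P Q"
    and x: "x \<in> Q" and y: "y \<in> Q" "y \<noteq> x" and ne: "a \<noteq> \<one>\<^bsub>tree_aut_group (pegs k)\<^esub>"
    and C: "C = {relabel k \<phi> a | \<phi>. \<phi> permutes pegs k \<and> \<phi> x = x}"
    and uv: "u \<in> lists (pegs k - {x})" "v \<in> lists (pegs k - {x})" "length u = length v"
  shows "(u, v) \<in> (steps C (pegs k))\<^sup>*"
proof -
  let ?\<sigma> = "root_perm (pegs k)" and ?R = "steps C (pegs k)" and ?X' = "pegs k - {x}"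
  have U: "P \<union> Q = pegs k" "P \<inter> Q = {}" and fixQ: "\<And>j. j \<in> Q \<Longrightarrow> ?\<sigma> a j = j"
    using PQ by (auto simp: hanoi_partition_def)
  have xk: "x < k" using U(1) x by auto
  obtain i where i: "?\<sigma> a i \<noteq> i"
    using hanoi_partition_id[OF PQ a] ne by (metis eq_id_iff)
  then have ik: "i < k" by (auto simp: root_perm_def split: if_splits)
  have i'k: "?\<sigma> a i < k" using root_perm_in[OF a] ik by auto
  \<comment> \<open>\<open>x\<close> is fixed by \<open>a\<close>, so by injectivity no other letter is sent to it.\<close>
  have "?\<sigma> a i \<noteq> x"
  proof
    assume e: "?\<sigma> a i = x"
    then have "a [i] = a [x]" using tree_aut_singleton[OF a] ik xk fixQ[OF x] by simp
    then have "i = x" using inj_onD[OF tree_aut_inj_on[OF a], of "[i]" "[x]"] ik xk by simp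
    then show False using i e by simp
  qed
  moreover have "i \<noteq> x" using i fixQ[OF x] by auto
  ultimately have iX: "i \<in> ?X'" "?\<sigma> a i \<in> ?X'" using ik i'k by auto
  have iQ: "i \<notin> Q" using i fixQ by auto
  have move: "(j # w, z # w) \<in> ?R"
    if jz: "j \<in> ?X'" "z \<in> ?X'" "j \<noteq> z" and w: "w \<in> lists (pegs k)" for j z w
  proof -
    obtain \<phi> where \<phi>: "\<phi> permutes pegs k" "\<phi> x = x" "\<phi> i = j" "\<phi> (?\<sigma> a i) = z"
      using moved_pair_extends[of i "pegs k" x "?\<sigma> a i" j z] iX jz i xk
      by (metis lessThan_iff)
    let ?c = "relabel k \<phi> a"
    have "j \<notin> \<phi> ` Q" using \<phi>(3) iQ permutes_inj[OF \<phi>(1)] by (auto dest: injD)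
    moreover have "inv_into UNIV \<phi> j = i" using \<phi>(1,3) by (metis permutes_inverses(2))
    ultimately have "?c (j # w) = z # w"
      using hanoi_partition_Cons[OF hanoi_partition_relabel[OF \<phi>(1) a PQ] relabel_in_tree_aut[OF \<phi>(1) a] w, of j]
        jz(1) \<phi>(4) by (simp add: root_perm_relabel[OF \<phi>(1) a])
    moreover have "?c \<in> C" using C \<phi>(1,2) by blast
    moreover have "j # w \<in> lists (pegs k)" using jz(1) w by simp
    ultimately show ?thesis by (rule stepsI[rotated 2])
  qed
  \<comment> \<open>If \<open>j = \<phi> y\<close> differs from \<open>z\<close>, the path is \<open>z # w\<close>, \<open>j # w\<close>, \<open>j # w'\<close>, \<open>z # w'\<close>.\<close>
  have lift1: "(z # w, z # w') \<in> ?R\<^sup>*" if "(w, w') \<in> ?R" and z: "z \<in> ?X'" for z w w'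
  proof -
    obtain \<phi> where \<phi>: "\<phi> permutes pegs k" "\<phi> x = x"
      and w': "w' = relabel k \<phi> a w" and w: "w \<in> lists (pegs k)"
      using \<open>(w, w') \<in> ?R\<close> C unfolding steps_def by auto
    let ?b = "relabel k \<phi> a" and ?j = "\<phi> y"
    have bt: "?b \<in> tree_aut (pegs k)" and bp: "hanoi_partition k ?b (\<phi> ` P) (\<phi> ` Q)"
      using relabel_in_tree_aut[OF \<phi>(1) a] hanoi_partition_relabel[OF \<phi>(1) a PQ] .
    have yk: "y \<in> pegs k" using U(1) y(1) by auto
    have jk: "?j < k" using permutes_in_image[OF \<phi>(1), of y] yk by simp
    have jx: "?j \<noteq> x" using \<phi> y(2) permutes_inj[OF \<phi>(1)] by (metis injD)
    have jX: "?j \<in> ?X'" using jk jx by simp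
    have "?\<sigma> ?b ?j = ?j" using bp y(1) by (simp add: hanoi_partition_def)
    then have "?b (?j # w) = ?j # w'"
      using hanoi_partition_Cons[OF bp bt w jk] y(1) w' by simp
    moreover have "?b \<in> C" using C \<phi> by blast
    moreover have "?j # w \<in> lists (pegs k)" using jk w by simp
    ultimately have mid: "(?j # w, ?j # w') \<in> ?R" by (rule stepsI[rotated 2])
    have w'l: "w' \<in> lists (pegs k)" unfolding w' by (rule tree_aut_in_lists[OF bt w])
    show ?thesis
    proof (cases "z = ?j")
      case True
      then show ?thesis using mid by auto
    next
      case False
      then show ?thesis
        using move[OF z jX False w] mid move[OF jX z _ w'l]
        by (metis converse_rtrancl_into_rtrancl r_into_rtrancl)
    qed
  qed
  have lift: "(z # w, z # w') \<in> ?R\<^sup>*" if "(w, w') \<in> ?R\<^sup>*" and z: "z \<in> ?X'" for z w w'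
    using that(1) by (induction rule: rtrancl_induct) (auto intro: rtrancl_trans lift1[OF _ z])
  show ?thesis using uv(3,1,2)
  proof (induction u v rule: list_induct2)
    case Nil then show ?case by simp
  next
    case (Cons j u z v)
    then have jz: "j \<in> ?X'" "z \<in> ?X'" and u: "u \<in> lists (pegs k)" and IH: "(u, v) \<in> ?R\<^sup>*"
      by auto
    have "(j # u, z # u) \<in> ?R\<^sup>*"
      by (cases "j = z") (use move[OF jz _ u] in auto)
    then show ?case using lift[OF IH jz(2)] by (rule rtrancl_trans)
  qed
qed

lemma inactive_peg_unique:
  assumes G: "hanoi_group k G S" and sym: "fully_symmetric k S" and con: "contracting (pegs k) G"
    and a: "a \<in> S" "a \<noteq> \<one>\<^bsub>tree_aut_group (pegs k)\<^esub>"
    and k: "k \<ge> 3"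
    and x: "x \<in> inactive_pegs k a" and y: "y \<in> inactive_pegs k a"
  shows "y = x"
proof (rule ccontr)
  assume yx: "y \<noteq> x"
  let ?T = "tree_aut_group (pegs k)" and ?X' = "pegs k - {x}"
  have ha: "hanoi_aut k a" using G a(1) by (auto simp: hanoi_group_def hanoi_auts_def hanoi_auts_q_def)
  then have at: "a \<in> tree_aut (pegs k)" by (simp add: hanoi_aut_def)
  obtain P where PQ: "hanoi_partition k a P (inactive_pegs k a)" using hanoi_aut_partition[OF ha] .
  have xk: "x \<in> pegs k" using PQ x by (auto simp: hanoi_partition_def)
  have GT: "subgroup G ?T" and GS: "G = generate ?T S" using G by (auto simp: hanoi_group_def)
  have Gt: "g \<in> tree_aut (pegs k)" if "g \<in> G" for g
    using subgroup.mem_carrier[OF GT that] by (simp add: carrier_tree_aut_group)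
  define C where "C = {relabel k \<phi> a | \<phi>. \<phi> permutes pegs k \<and> \<phi> x = x}"
  \<comment> \<open>Fixing the letter \<open>x\<close> is what makes the condition on sections pass to products.\<close>
  define A where "A = {g \<in> G. g [x] = [x] \<and> letter_section (pegs k) g x = g}"
  have finA: "finite A"
    by (rule finite_subset[OF _ contracting_finite_fixed_sections[OF con xk]]) (auto simp: A_def)
  have CA: "C \<subseteq> A"
  proof
    fix c assume "c \<in> C"
    then obtain \<phi> where \<phi>: "\<phi> permutes pegs k" "\<phi> x = x" and c: "c = relabel k \<phi> a"
      unfolding C_def by blast
    have "peg_action k \<phi> a \<in> S" using sym a(1) \<phi>(1) unfolding fully_symmetric_def by blast
    then have "c \<in> S" by (simp only: c peg_action_eq_relabel[OF \<phi>(1) ha a(2)])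
    then have cG: "c \<in> G" unfolding GS by (rule generate.incl)
    have "x \<in> \<phi> ` inactive_pegs k a" using x \<phi>(2) by (metis imageI)
    then have "letter_section (pegs k) c x = c" "root_perm (pegs k) c x = x"
      using hanoi_partition_relabel[OF \<phi>(1) at PQ] by (auto simp: hanoi_partition_def c)
    then show "c \<in> A" using cG tree_aut_singleton[OF Gt[OF cG] xk] by (simp add: A_def)
  qed
  have oneA: "\<one>\<^bsub>?T\<^esub> \<in> A"
    using subgroup.one_closed[OF GT] xk
    by (auto simp: A_def one_tree_aut_group letter_section_def restrict_def fun_eq_iff)
  have multA: "g \<otimes>\<^bsub>?T\<^esub> h \<in> A" if "g \<in> A" "h \<in> A" for g h
  proof -
    have gh: "g \<in> G" "h \<in> G" using that by (auto simp: A_def)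
    show ?thesis
      using subgroup.m_closed[OF GT gh] letter_section_mult_fixed[OF Gt[OF gh(1)] Gt[OF gh(2)] xk] that xk
      by (auto simp: A_def mult_tree_aut_group[OF Gt[OF gh(1)] Gt[OF gh(2)]] compose_def)
  qed
  have reach: "\<exists>g\<in>A. g u = v" if "(u, v) \<in> (steps C (pegs k))\<^sup>*" "u \<in> lists (pegs k)" for u v
    using that(1)
  proof (induction rule: rtrancl_induct)
    case base
    then show ?case using oneA that(2) by (intro bexI[of _ "\<one>\<^bsub>?T\<^esub>"]) (auto simp: one_tree_aut_group)
  next
    case (step v w)
    then obtain g c where g: "g \<in> A" "g u = v" and c: "c \<in> C" "w = c v" unfolding steps_def by auto
    then have "g \<in> G" "c \<in> G" using CA by (auto simp: A_def)
    then have "(c \<otimes>\<^bsub>?T\<^esub> g) u = w"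
      using that(2) g c by (simp add: mult_tree_aut_group Gt compose_eq del: in_lists_conv_set)
    moreover have "c \<otimes>\<^bsub>?T\<^esub> g \<in> A" using multA g c CA by blast
    ultimately show ?case by blast
  qed
  \<comment> \<open>The words of length \<open>card A\<close> form a single orbit, and there are more than \<open>card A\<close> of them.\<close>
  let ?n = "card A"
  let ?W = "{w. set w \<subseteq> ?X' \<and> length w = ?n}"
  have cX': "card ?X' = k - 1" using xk by simp
  then have "0 < card ?X'" using k by simp
  then obtain z where z: "z \<in> ?X'" by (metis card_gt_0_iff ex_in_conv)
  let ?u = "replicate ?n z"
  have "?W \<subseteq> (\<lambda>g. g ?u) ` A"
  proof
    fix w assume "w \<in> ?W"
    then have w: "w \<in> lists ?X'" "length ?u = length w" by auto
    have u: "?u \<in> lists ?X'" "?u \<in> lists (pegs k)" using z by auto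
    show "w \<in> (\<lambda>g. g ?u) ` A"
      using reach[OF steps_transitive[OF at PQ x y yx a(2) C_def u(1) w] u(2)] by blast
  qed
  then have "card ?W \<le> ?n" using surj_card_le[OF finA] by blast
  moreover have "card ?W = (k - 1) ^ ?n" using card_lists_length_eq[of ?X' ?n] cX' by simp
  moreover have "?n < 2 ^ ?n" by simp
  moreover have "(2::nat) ^ ?n \<le> (k - 1) ^ ?n" using k by (intro power_mono) auto
  ultimately show False by linarith
qed

theorem theorem6p1:
  fixes k :: nat and G S :: "(nat list \<Rightarrow> nat list) set"
  assumes "k \<ge> 3"
    and "hanoi_group k G S"
    and "fully_symmetric k S"
    and "contracting (pegs k) G"
  shows "subgroup G ((tree_aut_group (pegs k))\<lparr>carrier := hanoi_c k\<rparr>)"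
proof -
  let ?T = "tree_aut_group (pegs k)"
  have GT: "subgroup G ?T" and GS: "G = generate ?T S" and SH: "S \<subseteq> hanoi_auts k"
    using assms(2) by (auto simp: hanoi_group_def)
  have "S \<subseteq> hanoi_auts_q k 1 \<union> {\<one>\<^bsub>?T\<^esub>}"
  proof
    fix a assume a: "a \<in> S"
    have "card (inactive_pegs k a) = 1" if "a \<noteq> \<one>\<^bsub>?T\<^esub>"
    proof -
      have "card (inactive_pegs k a) \<ge> 1" using a SH by (auto simp: hanoi_auts_def hanoi_auts_q_def)
      then obtain x where "x \<in> inactive_pegs k a" by fastforce
      then have "inactive_pegs k a = {x}"
        using inactive_peg_unique[OF assms(2,3,4) a that assms(1)] by blast
      then show ?thesis by simp
    qed
    then show "a \<in> hanoi_auts_q k 1 \<union> {\<one>\<^bsub>?T\<^esub>}"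
      using a SH by (auto simp: hanoi_auts_def hanoi_auts_q_def)
  qed
  then have "G \<subseteq> hanoi_c k"
    unfolding GS hanoi_c_def by (rule group.mono_generate[OF group_tree_aut_group])
  moreover have "subgroup (hanoi_c k) ?T" unfolding hanoi_c_def
    by (rule group.generate_is_subgroup[OF group_tree_aut_group])
      (auto simp: hanoi_auts_q_def hanoi_aut_def carrier_tree_aut_group one_tree_aut_group id_in_tree_aut)
  ultimately show ?thesis
    by (intro group.subgroup_incl[OF group_tree_aut_group GT])
qed

end
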